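(* Let $\mathcal T$ be a kite and dart tiling with kites having longest edge of length $1$, with coordinates normalized as described in the context. Then each kite of the tiling is the translate of either a $\Delta_k^+$, $k=0,\dots,4$, or a $\Delta_k^-$, $k=0,\dots,4$. Moreover, each vertex of the tiling lies in the quasilattice $R$.
   Context: Let $\phi=\frac{1+\sqrt5}{2}$. A kite (with longest edges of length $1$) is a quadrilateral with consecutive vertices $E,B,A,G$, interior angles $2\pi/5$ at $E,B,G$ and $4\pi/5$ at $A$, with $|EB|=|EG|=|EA|=1$ and $|AB|=|AG|=1/\phi$. A dart is a nonconvex quadrilateral with consecutive vertices $F,B,A,G$, interior angles $2\pi/5$ at $F$, $\pi/5$ at $B$ and $G$, $6\pi/5$ at $A$, with $|FB|=|FG|=1$ and $|AB|=|AG|=1/\phi$. A kite and dart tiling is an edge-to-edge tiling of the plane by such kites and darts obeying the Penrose matching rules: colour black the vertices $E,A$ of each kite and $B,G$ of each dart, and colour white the vertices $B,G$ of each kite and $A,F$ of each dart; tiles may only be joined so that the vertex colours agree. For $k=0,\dots,4$ let $Y_k^*=(-\sin\frac{2\pi k}5,\cos\frac{2\pi k}5)\in\mathbb R^2$ (so $Y_0^*=(0,1)$ and $Y_0^*=-(Y_1^*+Y_2^*+Y_3^*+Y_4^* )$), and let $R=\mathrm{Span}_{\mathbb Z}\{Y_0^*,\dots,Y_4^*\}$. Let $\Delta_k^+$ be the kite with $E$ at the origin and $A-E=Y_k^*$, and $\Delta_k^-$ the kite with $E$ at the origin and $A-E=-Y_k^*$. Coordinates: one chooses an edge of the tiling,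 and coordinates so that one of its endpoints is the origin $O$ and the vector from this endpoint to the other is parallel to $Y_0^*$ with the same orientation. *)

theory Defs
  imports "HOL-Analysis.Analysis"
begin

text \<open>
  The Euclidean plane is the type \<^typ>\<open>complex\<close>, with (x, y) written as \<open>Complex x y\<close>.
\<close>

definition golden :: real where
  "golden = (1 + sqrt 5) / 2"

text \<open>
  Interior angle at \<open>V\<close> of a simple polygon traversed counterclockwise, where \<open>P\<close>, \<open>V\<close>, \<open>N\<close> are
  consecutive vertices. It takes values in [0, 2 pi), so reflex angles are covered.
\<close>

definition interior_angle :: "complex \<Rightarrow> complex \<Rightarrow> complex \<Rightarrow> real" where
  "interior_angle P V N = Arg2pi ((P - V) / (N - V))"

text \<open>
  The vertices are consecutive: \<open>E\<close>, \<open>B\<close>, \<open>A\<close>, \<open>G\<close> for a kite and \<open>F\<close>, \<open>B\<close>, \<open>A\<close>, \<open>G\<close> for a dart.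
  They are listed counterclockwise (enforced by the interior angles in \<open>is_tile\<close>). This is no
  restriction, as \<open>B\<close> and \<open>G\<close> play symmetric roles in both shapes, and it makes the labelling of
  a given kite or dart unique, so that a set of tiles can be represented by a set of labelled ones.
\<close>

datatype tile = Kite complex complex complex complex | Dart complex complex complex complex

fun is_tile :: "tile \<Rightarrow> bool" where
  "is_tile (Kite E B A G) \<longleftrightarrow>
     dist E B = 1 \<and> dist E G = 1 \<and> dist E A = 1 \<and> dist A B = 1 / golden \<and> dist A G = 1 / golden \<and>
     interior_angle G E B = 2 * pi / 5 \<and> interior_angle E B A = 2 * pi / 5 \<and>
     interior_angle B A G = 4 * pi / 5 \<and> interior_angle A G E = 2 * pi / 5"
| "is_tile (Dart F B A G) \<longleftrightarrow>
     dist F B = 1 \<and> dist F G = 1 \<and> dist A B = 1 / golden \<and> dist A G = 1 / golden \<and>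
     interior_angle G F B = 2 * pi / 5 \<and> interior_angle F B A = pi / 5 \<and>
     interior_angle B A G = 6 * pi / 5 \<and> interior_angle A G F = pi / 5"

text \<open>The segment \<open>F A\<close> cuts the nonconvex dart into two triangles.\<close>

fun region :: "tile \<Rightarrow> complex set" where
  "region (Kite E B A G) = convex hull {E, B, A, G}"
| "region (Dart F B A G) = convex hull {F, B, A} \<union> convex hull {F, A, G}"

fun vertices :: "tile \<Rightarrow> complex set" where
  "vertices (Kite E B A G) = {E, B, A, G}"
| "vertices (Dart F B A G) = {F, B, A, G}"

fun edges :: "tile \<Rightarrow> complex set set" where
  "edges (Kite E B A G) =
     {closed_segment E B, closed_segment B A, closed_segment A G, closed_segment G E}"
| "edges (Dart F B A G) =
     {closed_segment F B, closed_segment B A, closed_segment A G, closed_segment G F}"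

fun black_vertices :: "tile \<Rightarrow> complex set" where
  "black_vertices (Kite E B A G) = {E, A}"
| "black_vertices (Dart F B A G) = {B, G}"

fun white_vertices :: "tile \<Rightarrow> complex set" where
  "white_vertices (Kite E B A G) = {B, G}"
| "white_vertices (Dart F B A G) = {A, F}"

definition tiling :: "tile set \<Rightarrow> bool" where
  "tiling T \<longleftrightarrow>
     (\<forall>t\<in>T. is_tile t) \<and>
     (\<Union>t\<in>T. region t) = UNIV \<and>
     (\<forall>s\<in>T. \<forall>t\<in>T. s \<noteq> t \<longrightarrow> interior (region s) \<inter> interior (region t) = {})"

text \<open>
  Distinct tiles meet exactly in their common vertices and common edges. More than one edge may be
  shared, since a dart is not convex.
\<close>

definition edge_to_edge :: "tile set \<Rightarrow> bool" where
  "edge_to_edge T \<longleftrightarrow>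
     (\<forall>s\<in>T. \<forall>t\<in>T. s \<noteq> t \<longrightarrow>
        region s \<inter> region t = (vertices s \<inter> vertices t) \<union> \<Union>(edges s \<inter> edges t))"

definition matching_rules :: "tile set \<Rightarrow> bool" where
  "matching_rules T \<longleftrightarrow>
     (\<forall>s\<in>T. \<forall>t\<in>T. \<forall>v \<in> vertices s \<inter> vertices t.
        (v \<in> black_vertices s \<longleftrightarrow> v \<in> black_vertices t) \<and>
        (v \<in> white_vertices s \<longleftrightarrow> v \<in> white_vertices t))"

definition kite_dart_tiling :: "tile set \<Rightarrow> bool" where
  "kite_dart_tiling T \<longleftrightarrow> tiling T \<and> edge_to_edge T \<and> matching_rules T"

definition Ystar :: "nat \<Rightarrow> complex" where
  "Ystar k = Complex (- sin (2 * pi * real k / 5)) (cos (2 * pi * real k / 5))"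

text \<open>The integer span of the five vectors \<open>Ystar 0\<close>, ..., \<open>Ystar 4\<close>.\<close>

definition quasilattice :: "complex set" where
  "quasilattice = {\<Sum>k\<le>4. of_int (c k) * Ystar k | c :: nat \<Rightarrow> int. True}"

text \<open>
  The kite with \<open>E\<close> at the origin and \<open>A - E\<close> equal to \<open>Ystar k\<close>, respectively \<open>- Ystar k\<close>.
  The lemmas \<open>Delta_plus_unique\<close> and \<open>Delta_minus_unique\<close> below show that the coordinates given
  here for \<open>B\<close> and \<open>G\<close> are the only possible ones.
\<close>

definition Delta_plus :: "nat \<Rightarrow> tile" where
  "Delta_plus k = Kite 0 (cis (- pi / 5) * Ystar k) (Ystar k) (cis (pi / 5) * Ystar k)"

definition Delta_minus :: "nat \<Rightarrow> tile" where
  "Delta_minus k = Kite 0 (cis (- pi / 5) * (- Ystar k)) (- Ystar k) (cis (pi / 5) * (- Ystar k))"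

fun translate :: "complex \<Rightarrow> tile \<Rightarrow> tile" where
  "translate v (Kite E B A G) = Kite (v + E) (v + B) (v + A) (v + G)"
| "translate v (Dart F B A G) = Dart (v + F) (v + B) (v + A) (v + G)"

text \<open>
  One of the edges of the tiling has the origin as an endpoint, and the vector from the origin to
  its other endpoint is a positive multiple of \<open>Ystar 0\<close>.
\<close>

definition normalized_coordinates :: "tile set \<Rightarrow> bool" where
  "normalized_coordinates T \<longleftrightarrow>
     (\<exists>t\<in>T. \<exists>P c. closed_segment 0 P \<in> edges t \<and> c > 0 \<and> P = c *\<^sub>R Ystar 0)"

lemma golden_pos: "golden > 0"
  by (simp add: golden_def add_pos_nonneg)

lemma cos_pi_5: "2 * cos (pi / 5) = golden"
proof -
  define c where "c = cos (pi / 5)"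
  have c0: "c > 0" unfolding c_def by (rule cos_gt_zero) auto
  have "cos (2 * (pi / 5)) = - cos (3 * (pi / 5))"
    using cos_minus_pi[of "3 * (pi / 5)"] cos_minus[of "2 * (pi / 5)"]
    by (simp add: cos_periodic_pi field_simps)
  hence "2 * c\<^sup>2 - 1 = - (4 * c ^ 3 - 3 * c)"
    unfolding c_def by (simp only: cos_double_cos cos_treble_cos)
  hence "(c + 1) * (4 * c\<^sup>2 - 2 * c - 1) = 0"
    by (simp add: algebra_simps power2_eq_square power3_eq_cube)
  hence "4 * c\<^sup>2 - 2 * c - 1 = 0" using c0 by simp
  hence "(4 * c - 1)\<^sup>2 = 5" by (simp add: power2_eq_square algebra_simps)
  hence "\<bar>4 * c - 1\<bar> = sqrt 5" by (metis real_sqrt_abs)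
  moreover have "4 * c - 1 \<ge> 0"
  proof (rule ccontr)
    assume "\<not> 4 * c - 1 \<ge> 0"
    with c0 have "\<bar>4 * c - 1\<bar> < 1" by auto
    moreover have "sqrt 5 > (1::real)" by simp
    ultimately show False using \<open>\<bar>4 * c - 1\<bar> = sqrt 5\<close> by linarith
  qed
  ultimately show ?thesis by (simp add: golden_def c_def)
qed

lemma interior_angle_eq_iff:
  assumes "P \<noteq> V" "N \<noteq> V" "0 \<le> a" "a < 2 * pi"
  shows "interior_angle P V N = a \<longleftrightarrow>
           P - V = of_real (dist P V / dist N V) * cis a * (N - V)"
proof -
  have z: "(P - V) / (N - V) \<noteq> 0" using assms by simp
  have n: "cmod ((P - V) / (N - V)) = dist P V / dist N V"
    by (simp add: norm_divide dist_norm)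
  have pos: "dist P V / dist N V > 0" using assms by simp
  have "interior_angle P V N = a \<longleftrightarrow> (P - V) / (N - V) = of_real (dist P V / dist N V) * cis a"
  proof
    assume "interior_angle P V N = a"
    thus "(P - V) / (N - V) = of_real (dist P V / dist N V) * cis a"
      using Arg2pi_eq[of "(P - V) / (N - V)"] n
      by (simp add: interior_angle_def cis_conv_exp)
  next
    assume *: "(P - V) / (N - V) = of_real (dist P V / dist N V) * cis a"
    show "interior_angle P V N = a"
      unfolding interior_angle_def
      by (rule Arg2pi_unique[OF _ pos assms(3,4)]) (use * in \<open>simp add: cis_conv_exp\<close>)
  qed
  thus ?thesis using assms(2) by (simp add: divide_eq_eq)
qed

lemma cis_pi_5:
  fixes w g :: complex
  defines "w \<equiv> cis (pi / 5)" and "g \<equiv> of_real golden"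
  shows "w ^ 5 = -1" "w ^ 4 - w ^ 3 + w\<^sup>2 - w + 1 = 0" "g * w = w\<^sup>2 + 1"
proof -
  have g: "w + cis (- (pi / 5)) = g"
    unfolding w_def g_def cos_pi_5[symmetric] by (simp add: complex_eq_iff)
  have "w * cis (- (pi / 5)) = 1" unfolding w_def by (simp add: cis_mult)
  thus "g * w = w\<^sup>2 + 1"
    unfolding g[symmetric] by (simp add: algebra_simps power2_eq_square)
  show w5: "w ^ 5 = -1" unfolding w_def by (simp add: Complex.DeMoivre)
  moreover have "w ^ 5 + 1 = (w + 1) * (w ^ 4 - w ^ 3 + w\<^sup>2 - w + 1)"
    by (simp add: algebra_simps power_numeral_reduce)
  moreover have "w + 1 \<noteq> 0"
  proof
    assume "w + 1 = 0"
    hence "Re (w + 1) = 0" by simp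
    moreover have "cos (pi / 5) > 0" by (rule cos_gt_zero) auto
    ultimately show False by (simp add: w_def)
  qed
  ultimately show "w ^ 4 - w ^ 3 + w\<^sup>2 - w + 1 = 0" by simp
qed

lemma cis_pi_5_powers:
  "cis (2 * pi / 5) = cis (pi / 5) ^ 2" "cis (4 * pi / 5) = cis (pi / 5) ^ 4"
  "cis (6 * pi / 5) = cis (pi / 5) ^ 6"
  by (simp_all add: Complex.DeMoivre mult.commute)

lemma dist_eq_inverse_golden:
  assumes "of_real golden * (P - Q) = z" "cmod z = 1"
  shows "dist P Q = 1 / golden"
proof -
  have "golden * cmod (P - Q) = 1"
    using assms golden_pos by (metis abs_of_pos norm_mult norm_of_real)
  thus ?thesis using golden_pos by (simp add: dist_norm field_simps)
qed

lemma is_tile_Kite_iff: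
  "is_tile (Kite E B A G) \<longleftrightarrow>
     dist E B = 1 \<and> A - E = cis (pi / 5) * (B - E) \<and> G - E = cis (pi / 5) ^ 2 * (B - E)"
  (is "?l \<longleftrightarrow> ?r")
proof -
  define w where "w = cis (pi / 5)"
  define g :: complex where "g = of_real golden"
  note w = cis_pi_5[folded w_def g_def]
  have nw: "cmod w = 1" by (simp add: w_def)
  have w0: "w \<noteq> 0" using nw by auto
  have g0: "golden > 0" "g \<noteq> 0" using golden_pos by (auto simp: g_def)
  have pi: "pi > 0" by simp
  show ?thesis
  proof
    assume l: ?l
    hence d: "dist E B = 1" "dist G E = 1" "dist B E = 1" "dist A B = 1 / golden"
      by (auto simp: dist_commute)
    hence ne: "E \<noteq> B" "B \<noteq> E" "G \<noteq> E" "A \<noteq> B" using g0 by auto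
    have "G - E = w\<^sup>2 * (B - E)"
      using l interior_angle_eq_iff[of G E B "2 * pi / 5"] ne d pi
      by (simp add: cis_pi_5_powers w_def)
    moreover have "E - B = g * w\<^sup>2 * (A - B)"
      using l interior_angle_eq_iff[of E B A "2 * pi / 5"] ne d pi
      by (simp add: cis_pi_5_powers w_def g_def)
    hence "g * w\<^sup>2 * (A - E - w * (B - E)) = 0"
      using w by algebra
    hence "A - E = w * (B - E)" using g0 w0 by simp
    ultimately show ?r using d by (simp add: w_def)
  next
    assume r: ?r
    define b where "b = B - E"
    have e: "B = E + b" "A = E + w * b" "G = E + w\<^sup>2 * b" and nb: "cmod b = 1"
      using r by (auto simp: b_def w_def algebra_simps dist_norm norm_minus_commute)
    have AB: "g * (A - B) = b * w ^ 3" using w w0 unfolding e by algebra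
    have AG: "g * (A - G) = - (b * w ^ 4)" using w w0 unfolding e by algebra
    have dAB: "dist A B = 1 / golden"
      by (rule dist_eq_inverse_golden[OF AB[unfolded g_def]]) (simp add: nb nw norm_mult norm_power)
    have dAG: "dist A G = 1 / golden"
      by (rule dist_eq_inverse_golden[OF AG[unfolded g_def]]) (simp add: nb nw norm_mult norm_power)
    have dE: "dist E B = 1" "dist E A = 1" "dist E G = 1"
      by (simp_all add: e dist_norm norm_mult norm_power nb nw)
    hence ne: "E \<noteq> B" "E \<noteq> A" "E \<noteq> G" "A \<noteq> B" "A \<noteq> G" using dAB dAG g0 by auto
    note d = dE dAB dAG dE[unfolded dist_commute[of E]] dAB[unfolded dist_commute[of A]]
      dAG[unfolded dist_commute[of A]]
    have "interior_angle G E B = 2 * pi / 5"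
      using ne d pi by (subst interior_angle_eq_iff) (auto simp: cis_pi_5_powers w_def[symmetric] e)
    moreover have "E - B = g * w\<^sup>2 * (A - B)" using AB w unfolding e by algebra
    hence "interior_angle E B A = 2 * pi / 5"
      using ne d pi by (subst interior_angle_eq_iff) (auto simp: cis_pi_5_powers w_def[symmetric] g_def)
    moreover have "B - A = w ^ 4 * (G - A)" using w unfolding e by algebra
    hence "interior_angle B A G = 4 * pi / 5"
      using ne d pi g0 by (subst interior_angle_eq_iff) (auto simp: cis_pi_5_powers w_def[symmetric])
    moreover have "g * (A - G) = w\<^sup>2 * (E - G)" using AG w unfolding e by algebra
    hence "A - G = w\<^sup>2 * (E - G) / g" using g0 by (simp add: field_simps)
    hence "interior_angle A G E = 2 * pi / 5"
      using ne d pi by (subst interior_angle_eq_iff) (auto simp: cis_pi_5_powers w_def[symmetric] g_def)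
    ultimately show ?l using d by simp
  qed
qed

lemma is_tile_Dart_iff:
  "is_tile (Dart F B A G) \<longleftrightarrow>
     dist F B = 1 \<and> of_real golden * (A - F) = cis (pi / 5) * (B - F) \<and>
     G - F = cis (pi / 5) ^ 2 * (B - F)"
  (is "?l \<longleftrightarrow> ?r")
proof -
  define w where "w = cis (pi / 5)"
  define g :: complex where "g = of_real golden"
  note w = cis_pi_5[folded w_def g_def]
  have nw: "cmod w = 1" by (simp add: w_def)
  have w0: "w \<noteq> 0" using nw by auto
  have g0: "golden > 0" "g \<noteq> 0" using golden_pos by (auto simp: g_def)
  have pi: "pi > 0" by simp
  show ?thesis
  proof
    assume l: ?l
    hence d: "dist F B = 1" "dist G F = 1" "dist B F = 1" "dist A B = 1 / golden"
      by (auto simp: dist_commute)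
    hence ne: "F \<noteq> B" "B \<noteq> F" "G \<noteq> F" "A \<noteq> B" using g0 by auto
    have "G - F = w\<^sup>2 * (B - F)"
      using l interior_angle_eq_iff[of G F B "2 * pi / 5"] ne d pi
      by (simp add: cis_pi_5_powers w_def)
    moreover have "F - B = g * w * (A - B)"
      using l interior_angle_eq_iff[of F B A "pi / 5"] ne d pi
      by (simp add: w_def g_def)
    hence "w * (g * (A - F) - w * (B - F)) = 0"
      using w by algebra
    hence "g * (A - F) = w * (B - F)" using w0 by simp
    ultimately show ?r using d by (simp add: w_def g_def)
  next
    assume r: ?r
    define b where "b = B - F"
    have e: "B = F + b" "G = F + w\<^sup>2 * b" and nb: "cmod b = 1"
      and a: "g * (A - F) = w * b"
      using r by (auto simp: b_def w_def g_def algebra_simps dist_norm norm_minus_commute)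
    have AB: "g * (A - B) = b * w ^ 4" using w a w0 unfolding e by algebra
    have AG: "g * (A - G) = - (b * w ^ 3)" using w a w0 unfolding e by algebra
    have dAB: "dist A B = 1 / golden"
      by (rule dist_eq_inverse_golden[OF AB[unfolded g_def]]) (simp add: nb nw norm_mult norm_power)
    have dAG: "dist A G = 1 / golden"
      by (rule dist_eq_inverse_golden[OF AG[unfolded g_def]]) (simp add: nb nw norm_mult norm_power)
    have dF: "dist F B = 1" "dist F G = 1"
      by (simp_all add: e dist_norm norm_mult norm_power nb nw)
    hence ne: "F \<noteq> B" "F \<noteq> G" "A \<noteq> B" "A \<noteq> G" using dAB dAG g0 by auto
    note d = dF dAB dAG dF[unfolded dist_commute[of F]] dAB[unfolded dist_commute[of A]]
      dAG[unfolded dist_commute[of A]]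
    have "interior_angle G F B = 2 * pi / 5"
      using ne d pi by (subst interior_angle_eq_iff) (auto simp: cis_pi_5_powers w_def[symmetric] e)
    moreover have "F - B = g * w * (A - B)" using AB w unfolding e by algebra
    hence "interior_angle F B A = pi / 5"
      using ne d pi by (subst interior_angle_eq_iff) (auto simp: w_def[symmetric] g_def)
    moreover have "g * (B - A) = g * (w ^ 6 * (G - A))" using AB AG w by algebra
    hence "B - A = w ^ 6 * (G - A)" using g0 by simp
    hence "interior_angle B A G = 6 * pi / 5"
      using ne d pi g0 by (subst interior_angle_eq_iff) (auto simp: cis_pi_5_powers w_def[symmetric])
    moreover have "g * (A - G) = w * (F - G)" using AG w unfolding e by algebra
    hence "A - G = w * (F - G) / g" using g0 by (simp add: field_simps)
    hence "interior_angle A G F = pi / 5"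
      using ne d pi by (subst interior_angle_eq_iff) (auto simp: w_def[symmetric] g_def)
    ultimately show ?l using d by simp
  qed
qed

lemma is_tile_Kite_0_iff:
  assumes "cmod u = 1"
  shows "is_tile (Kite 0 B u G) \<longleftrightarrow> B = cis (- pi / 5) * u \<and> G = cis (pi / 5) * u"
proof -
  have i: "cis (- pi / 5) * cis (pi / 5) = 1" by (simp add: cis_mult)
  have "u = cis (pi / 5) * B \<longleftrightarrow> B = cis (- pi / 5) * u"
    using i by algebra
  moreover have "cis (pi / 5) ^ 2 * (cis (- pi / 5) * u) = cis (pi / 5) * u"
    using i by algebra
  ultimately show ?thesis
    using assms by (auto simp: is_tile_Kite_iff norm_mult power2_eq_square simp del: is_tile.simps)
qed

lemma norm_Ystar: "cmod (Ystar k) = 1"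
  by (simp add: Ystar_def cmod_def)

lemma Delta_plus_unique:
  "is_tile (Kite 0 B A G) \<and> A = Ystar k \<longleftrightarrow> Kite 0 B A G = Delta_plus k"
  using is_tile_Kite_0_iff[OF norm_Ystar] by (auto simp: Delta_plus_def)

lemma Delta_minus_unique:
  "is_tile (Kite 0 B A G) \<and> A = - Ystar k \<longleftrightarrow> Kite 0 B A G = Delta_minus k"
  using is_tile_Kite_0_iff[of "- Ystar k"] norm_Ystar by (auto simp: Delta_minus_def)

end

theory Submission
  imports Defs
begin

text \<open>
  Write \<open>\<zeta> = cis (pi / 5)\<close>. The ten unit vectors \<open>\<plusminus> Ystar k\<close> are exactly the vectors
  \<open>\<i> * \<zeta> ^ j\<close>, so they are permuted by multiplication with \<open>\<zeta>\<close>.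

  A tile is determined by the vertex at which its two edges of length \<open>1\<close> meet (\<open>E\<close> in a kite, \<open>F\<close>
  in a dart) and the unit vector \<open>b\<close> from there to \<open>B\<close>:
  every edge is a positive multiple of some \<open>\<zeta> ^ k * b\<close>, and every difference of two vertices is an
  integer combination of such vectors, because \<open>1 / golden = \<zeta> + 1 / \<zeta> - 1\<close>. Hence, if a single edge
  of a tile is parallel to some \<open>\<plusminus> Ystar k\<close> and ends in the quasilattice, then \<open>b\<close> is one of these ten
  vectors and all vertices of the tile lie in the quasilattice. This property therefore passes
  from a tile to any tile sharing an edge with it, and the normalization of the coordinates says
  that some tile has it (\<open>well_placedI\<close>).

  It remains to see that any two tiles are joined by a chain of tiles, each sharing an edge with
  the next (\<open>tiling_edge_induct\<close>). Otherwise the plane would be the union of two nonempty families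
  of tiles that have no edge in common. The tiling is locally finite, so both families cover
  closed sets, and these sets meet only in vertices, of which there are countably many.
  This contradicts the connectedness of the plane minus a countable set.
\<close>

section \<open>Tenth roots of unity and the quasilattice\<close>

definition zeta :: complex where
  "zeta = cis (pi / 5)"

lemma zeta_pow_5: "zeta ^ 5 = -1"
  and zeta_cyclotomic: "zeta ^ 4 - zeta ^ 3 + zeta\<^sup>2 - zeta + 1 = 0"
  and golden_zeta: "of_real golden * zeta = zeta\<^sup>2 + 1"
  using cis_pi_5 by (simp_all add: zeta_def)

lemma norm_zeta: "cmod zeta = 1"
  by (simp add: zeta_def)

lemma zeta_nonzero: "zeta \<noteq> 0"
  by (simp add: zeta_def)

lemma zeta_pow_10: "zeta ^ 10 = 1"
proof -
  have "zeta ^ 10 = (zeta ^ 5) ^ 2" by (simp flip: power_mult)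
  thus ?thesis by (simp add: zeta_pow_5)
qed

lemma zeta_pow_mod_10: "zeta ^ (n mod 10) = zeta ^ n"
proof -
  have "zeta ^ n = zeta ^ (10 * (n div 10) + n mod 10)" by simp
  also have "\<dots> = zeta ^ (n mod 10)" by (simp only: power_add power_mult zeta_pow_10) simp
  finally show ?thesis ..
qed

lemma zeta_pow_plus_5: "zeta ^ (n + 5) = - (zeta ^ n)"
  by (simp add: power_add zeta_pow_5)

lemma Ystar_eq_zeta: "Ystar k = \<i> * zeta ^ (2 * k)"
  by (simp add: Ystar_def zeta_def Complex.DeMoivre complex_eq_iff algebra_simps)

definition lattice_directions :: "complex set" where
  "lattice_directions = range (\<lambda>j. \<i> * zeta ^ j)"

lemma zeta_pow_lattice_direction:
  assumes "u \<in> lattice_directions"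
  shows "zeta ^ k * u \<in> lattice_directions"
proof -
  obtain j where "u = \<i> * zeta ^ j" using assms by (auto simp: lattice_directions_def)
  hence "zeta ^ k * u = \<i> * zeta ^ (k + j)" by (simp add: power_add)
  thus ?thesis by (auto simp: lattice_directions_def)
qed

lemma lattice_direction_zeta_pow_cancel:
  assumes "zeta ^ k * u \<in> lattice_directions"
  shows "u \<in> lattice_directions"
proof -
  have "zeta ^ (9 * k) * (zeta ^ k * u) = (zeta ^ 10) ^ k * u"
    by (simp add: mult.assoc[symmetric] flip: power_add power_mult)
  hence "u = zeta ^ (9 * k) * (zeta ^ k * u)" by (simp add: zeta_pow_10)
  thus ?thesis using zeta_pow_lattice_direction[OF assms] by metis
qed

lemma lattice_direction_cases:
  assumes "u \<in> lattice_directions"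
  obtains k where "k \<le> 4" "u = Ystar k \<or> u = - Ystar k"
proof -
  have even_power: "\<exists>k\<le>4. \<i> * zeta ^ j = Ystar k" if j: "even j" for j
  proof -
    obtain m where m: "j = 2 * m" using j by blast
    have "zeta ^ (2 * (m mod 5)) = zeta ^ ((2 * m) mod 10)"
      by (simp add: mult_mod_right)
    hence "\<i> * zeta ^ j = Ystar (m mod 5)"
      by (simp add: m Ystar_eq_zeta zeta_pow_mod_10)
    moreover have "m mod 5 \<le> 4" by simp
    ultimately show ?thesis by blast
  qed
  obtain j where j: "u = \<i> * zeta ^ j" using assms by (auto simp: lattice_directions_def)
  show ?thesis
  proof (cases "even j")
    case True
    thus ?thesis using even_power[OF True] j that by blast
  next
    case False
    hence "even (j + 5)" by simp
    from even_power[OF this] obtain k where "k \<le> 4" "\<i> * zeta ^ (j + 5) = Ystar k" by blast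
    hence "u = - Ystar k" unfolding j zeta_pow_plus_5 by (metis minus_minus mult_minus_right)
    thus ?thesis using \<open>k \<le> 4\<close> that by blast
  qed
qed

lemma quasilattice_zero: "0 \<in> quasilattice"
  unfolding quasilattice_def by (rule CollectI, rule exI[of _ "\<lambda>_. 0"]) simp

lemma quasilattice_add:
  assumes "x \<in> quasilattice" "y \<in> quasilattice"
  shows "x + y \<in> quasilattice"
proof -
  obtain c d :: "nat \<Rightarrow> int" where "x = (\<Sum>k\<le>4. of_int (c k) * Ystar k)"
    "y = (\<Sum>k\<le>4. of_int (d k) * Ystar k)"
    using assms by (auto simp: quasilattice_def)
  hence "x + y = (\<Sum>k\<le>4. of_int (c k + d k) * Ystar k)"
    by (simp only: sum.distrib of_int_add distrib_right)
  thus ?thesis unfolding quasilattice_def by (intro CollectI exI[of _ "\<lambda>k. c k + d k"]) simp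
qed

lemma quasilattice_minus:
  assumes "x \<in> quasilattice"
  shows "- x \<in> quasilattice"
proof -
  obtain c :: "nat \<Rightarrow> int" where "x = (\<Sum>k\<le>4. of_int (c k) * Ystar k)"
    using assms by (auto simp: quasilattice_def)
  hence "- x = (\<Sum>k\<le>4. of_int (- c k) * Ystar k)"
    by (simp only: of_int_minus mult_minus_left sum_negf)
  thus ?thesis unfolding quasilattice_def by (intro CollectI exI[of _ "\<lambda>k. - c k"]) simp
qed

lemma quasilattice_diff:
  assumes "x \<in> quasilattice" "y \<in> quasilattice"
  shows "x - y \<in> quasilattice"
  using quasilattice_add[OF assms(1) quasilattice_minus[OF assms(2)]] by simp

lemma Ystar_in_quasilattice:
  assumes "k \<le> 4"
  shows "Ystar k \<in> quasilattice"
proof -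
  have "(\<Sum>i\<le>4. of_int (if i = k then 1 else 0) * Ystar i) = (\<Sum>i\<le>4. if i = k then Ystar i else 0)"
    by (rule sum.cong) auto
  also have "\<dots> = Ystar k" using assms by simp
  finally show ?thesis
    unfolding quasilattice_def by (intro CollectI exI[of _ "\<lambda>i. if i = k then 1 else 0"]) simp
qed

lemma lattice_direction_in_quasilattice:
  assumes "u \<in> lattice_directions"
  shows "u \<in> quasilattice"
  using lattice_direction_cases[OF assms] Ystar_in_quasilattice quasilattice_minus by metis


section \<open>Shape and position of a tile\<close>

fun anchor :: "tile \<Rightarrow> complex" where
  "anchor (Kite E B A G) = E"
| "anchor (Dart F B A G) = F"

fun arm :: "tile \<Rightarrow> complex" where
  "arm (Kite E B A G) = B - E"
| "arm (Dart F B A G) = B - F"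

text \<open>
  In the dart, \<open>A\<close> lies on the ray through \<open>\<zeta> * b\<close> at distance \<open>1 / golden\<close> from \<open>F\<close>. Since
  \<open>\<zeta> / golden = \<zeta>\<^sup>2 - \<zeta> + 1\<close>, its position is a polynomial in \<open>\<zeta>\<close> with integer coefficients, as for
  all the other vertices.
\<close>

lemma golden_zeta_poly: "of_real golden * (zeta\<^sup>2 - zeta + 1) = zeta"
proof -
  have "zeta * (of_real golden * (zeta\<^sup>2 - zeta + 1) - zeta) = 0"
    using golden_zeta zeta_cyclotomic by algebra
  thus ?thesis using zeta_nonzero by simp
qed

lemma tile_cases:
  assumes "is_tile t"
  obtains (kite) a b where "cmod b = 1" "anchor t = a" "arm t = b"
      "t = Kite a (a + b) (a + zeta * b) (a + zeta\<^sup>2 * b)"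
    | (dart) a b where "cmod b = 1" "anchor t = a" "arm t = b"
      "t = Dart a (a + b) (a + (zeta\<^sup>2 - zeta + 1) * b) (a + zeta\<^sup>2 * b)"
proof (cases t)
  case (Kite E B A G)
  hence "dist E B = 1" "A - E = zeta * (B - E)" "G - E = zeta\<^sup>2 * (B - E)"
    using assms is_tile_Kite_iff[of E B A G] by (simp_all add: zeta_def del: is_tile.simps)
  hence "t = Kite E (E + (B - E)) (E + zeta * (B - E)) (E + zeta\<^sup>2 * (B - E))" "cmod (B - E) = 1"
    using Kite by (simp_all add: dist_norm norm_minus_commute) (metis add.commute diff_add_cancel)
  thus ?thesis using kite[of "B - E" E] Kite by simp
next
  case (Dart F B A G)
  hence *: "dist F B = 1" "of_real golden * (A - F) = zeta * (B - F)" "G - F = zeta\<^sup>2 * (B - F)"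
    using assms is_tile_Dart_iff[of F B A G] by (simp_all add: zeta_def del: is_tile.simps)
  have "of_real golden * (A - F) = of_real golden * ((zeta\<^sup>2 - zeta + 1) * (B - F))"
    unfolding *(2) using golden_zeta_poly by (metis mult.assoc)
  hence "A - F = (zeta\<^sup>2 - zeta + 1) * (B - F)" using golden_pos by simp
  hence "t = Dart F (F + (B - F)) (F + (zeta\<^sup>2 - zeta + 1) * (B - F)) (F + zeta\<^sup>2 * (B - F))"
    "cmod (B - F) = 1"
    using * Dart by (simp_all add: dist_norm norm_minus_commute) (metis add.commute diff_add_cancel)
  thus ?thesis using dart[of "B - F" F] Dart by simp
qed

lemma norm_arm: "is_tile t \<Longrightarrow> cmod (arm t) = 1"
  by (erule tile_cases) simp_all

lemma vertex_minus_anchor_in_quasilattice: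
  assumes "is_tile t" "arm t \<in> lattice_directions" "v \<in> vertices t"
  shows "v - anchor t \<in> quasilattice"
proof -
  define b where "b = arm t"
  have b: "b \<in> quasilattice" "zeta * b \<in> quasilattice" "zeta\<^sup>2 * b \<in> quasilattice"
    using assms(2) zeta_pow_lattice_direction[of b 1] zeta_pow_lattice_direction[of b 2]
    by (auto simp: b_def intro!: lattice_direction_in_quasilattice)
  have "(zeta\<^sup>2 - zeta + 1) * b = zeta\<^sup>2 * b - zeta * b + b" by (simp add: algebra_simps)
  hence "(zeta\<^sup>2 - zeta + 1) * b \<in> quasilattice"
    using b by (simp add: quasilattice_add quasilattice_diff)
  from assms(1) show ?thesis
  proof (cases rule: tile_cases)
    case (kite a b')
    hence "v - anchor t \<in> {0, b, zeta * b, zeta\<^sup>2 * b}" using assms(3) by (auto simp: b_def)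
    thus ?thesis using b quasilattice_zero by (elim insertE emptyE) simp_all
  next
    case (dart a b')
    hence "v - anchor t \<in> {0, b, (zeta\<^sup>2 - zeta + 1) * b, zeta\<^sup>2 * b}"
      using assms(3) by (auto simp: b_def)
    thus ?thesis using b quasilattice_zero \<open>(zeta\<^sup>2 - zeta + 1) * b \<in> quasilattice\<close>
      by (elim insertE emptyE) simp_all
  qed
qed

definition positive_multiple_of_zeta_pow :: "complex \<Rightarrow> complex \<Rightarrow> bool" where
  "positive_multiple_of_zeta_pow b z \<longleftrightarrow> (\<exists>c>0. \<exists>k. z = of_real c * (zeta ^ k * b))"

lemma positive_multiple_of_zeta_pow_minus:
  assumes "positive_multiple_of_zeta_pow b z"
  shows "positive_multiple_of_zeta_pow b (- z)"
proof -
  obtain c k where "c > 0" "z = of_real c * (zeta ^ k * b)"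
    using assms by (auto simp: positive_multiple_of_zeta_pow_def)
  hence "c > 0" "- z = of_real c * (zeta ^ (k + 5) * b)" by (simp_all add: zeta_pow_plus_5)
  thus ?thesis unfolding positive_multiple_of_zeta_pow_def by blast
qed

lemma positive_multiple_of_zeta_powI:
  assumes "of_real golden * z = zeta ^ k * b"
  shows "positive_multiple_of_zeta_pow b z"
proof -
  have "z = of_real (1 / golden) * (zeta ^ k * b)"
    unfolding assms[symmetric] using golden_pos by simp
  moreover have "1 / golden > 0" using golden_pos by simp
  ultimately show ?thesis unfolding positive_multiple_of_zeta_pow_def by blast
qed

text \<open>
  The short edges are handled after multiplication by \<open>golden\<close>, where the claim becomes a polynomial
  identity in \<open>\<zeta>\<close>. A segment determines its end points only up to their order, but reversing an
  edge replaces \<open>\<zeta> ^ k\<close> by \<open>\<zeta> ^ (k + 5)\<close>.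
\<close>

lemma edge_direction:
  assumes "is_tile t" "closed_segment P Q \<in> edges t"
  shows "positive_multiple_of_zeta_pow (arm t) (Q - P)"
    and "P \<in> vertices t" "Q \<in> vertices t"
proof -
  have long: "positive_multiple_of_zeta_pow b (zeta ^ k * b)" for b k
    unfolding positive_multiple_of_zeta_pow_def by (intro exI[of _ 1] conjI exI[of _ k]) simp_all
  have unit_edge: "positive_multiple_of_zeta_pow b b" for b using long[of b 0] by simp
  have *: "\<exists>P' Q'. closed_segment P Q = closed_segment P' Q' \<and> P' \<in> vertices t \<and> Q' \<in> vertices t \<and>
      positive_multiple_of_zeta_pow (arm t) (Q' - P')"
    using assms(1)
  proof (cases rule: tile_cases)
    case (kite a b)
    have "of_real golden * (zeta * b - b) = zeta ^ 3 * b"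
      using golden_zeta zeta_cyclotomic zeta_pow_5 golden_zeta_poly by algebra
    note BA = positive_multiple_of_zeta_powI[OF this]
    have "of_real golden * (zeta\<^sup>2 * b - zeta * b) = zeta ^ 4 * b"
      using golden_zeta zeta_cyclotomic zeta_pow_5 golden_zeta_poly by algebra
    note AG = positive_multiple_of_zeta_powI[OF this]
    have GE: "positive_multiple_of_zeta_pow b (- (zeta\<^sup>2 * b))"
      by (intro positive_multiple_of_zeta_pow_minus long)
    consider "closed_segment P Q = closed_segment a (a + b)"
      | "closed_segment P Q = closed_segment (a + b) (a + zeta * b)"
      | "closed_segment P Q = closed_segment (a + zeta * b) (a + zeta\<^sup>2 * b)"
      | "closed_segment P Q = closed_segment (a + zeta\<^sup>2 * b) a"
      using assms(2) unfolding kite(4) edges.simps by blast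
    thus ?thesis
    proof cases
      case 1 thus ?thesis using unit_edge kite
        by (intro exI[of _ a] exI[of _ "a + b"]) auto
    next
      case 2 thus ?thesis using BA kite
        by (intro exI[of _ "a + b"] exI[of _ "a + zeta * b"]) auto
    next
      case 3 thus ?thesis using AG kite
        by (intro exI[of _ "a + zeta * b"] exI[of _ "a + zeta\<^sup>2 * b"]) auto
    next
      case 4 thus ?thesis using GE kite
        by (intro exI[of _ "a + zeta\<^sup>2 * b"] exI[of _ a]) auto
    qed
  next
    case (dart a b)
    let ?A = "(zeta\<^sup>2 - zeta + 1) * b"
    have "of_real golden * (?A - b) = zeta ^ 4 * b"
      using golden_zeta zeta_cyclotomic zeta_pow_5 golden_zeta_poly by algebra
    note BA = positive_multiple_of_zeta_powI[OF this]
    have "of_real golden * (zeta\<^sup>2 * b - ?A) = zeta ^ 3 * b"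
      using golden_zeta zeta_cyclotomic zeta_pow_5 golden_zeta_poly by algebra
    note AG = positive_multiple_of_zeta_powI[OF this]
    have GF: "positive_multiple_of_zeta_pow b (- (zeta\<^sup>2 * b))"
      by (intro positive_multiple_of_zeta_pow_minus long)
    consider "closed_segment P Q = closed_segment a (a + b)"
      | "closed_segment P Q = closed_segment (a + b) (a + ?A)"
      | "closed_segment P Q = closed_segment (a + ?A) (a + zeta\<^sup>2 * b)"
      | "closed_segment P Q = closed_segment (a + zeta\<^sup>2 * b) a"
      using assms(2) unfolding dart(4) edges.simps by blast
    thus ?thesis
    proof cases
      case 1 thus ?thesis using unit_edge dart
        by (intro exI[of _ a] exI[of _ "a + b"]) auto
    next
      case 2 thus ?thesis using BA dart
        by (intro exI[of _ "a + b"] exI[of _ "a + ?A"]) auto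
    next
      case 3 thus ?thesis using AG dart
        by (intro exI[of _ "a + ?A"] exI[of _ "a + zeta\<^sup>2 * b"]) auto
    next
      case 4 thus ?thesis using GF dart
        by (intro exI[of _ "a + zeta\<^sup>2 * b"] exI[of _ a]) auto
    qed
  qed
  then obtain P' Q' where **: "{P, Q} = {P', Q'}" "P' \<in> vertices t" "Q' \<in> vertices t"
      "positive_multiple_of_zeta_pow (arm t) (Q' - P')"
    by auto
  hence "P = P' \<and> Q = Q' \<or> P = Q' \<and> Q = P'" by (auto simp: doubleton_eq_iff)
  thus "positive_multiple_of_zeta_pow (arm t) (Q - P)" "P \<in> vertices t" "Q \<in> vertices t"
    using ** positive_multiple_of_zeta_pow_minus[OF **(4)] by auto
qed

text \<open>
  The positive factors compare lengths only, and all the other factors have modulus \<open>1\<close>; so they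
  agree, and the two unit vectors differ by a power of \<open>\<zeta>\<close>.
\<close>

lemma lattice_direction_parallel:
  assumes "u \<in> lattice_directions" "cmod b = 1" "c > 0"
    and "positive_multiple_of_zeta_pow b (of_real c * u)"
  shows "b \<in> lattice_directions"
proof -
  obtain d k where d: "d > 0" "of_real c * u = of_real d * (zeta ^ k * b)"
    using assms(4) by (auto simp: positive_multiple_of_zeta_pow_def)
  have "cmod u = 1"
    using assms(1) by (auto simp: lattice_directions_def norm_mult norm_power norm_zeta)
  hence "c = d"
    using arg_cong[OF d(2), of cmod] assms(2,3) d(1)
    by (simp add: norm_mult norm_power norm_zeta)
  hence "zeta ^ k * b = u" using d assms(3) by simp
  thus ?thesis using assms(1) lattice_direction_zeta_pow_cancel by blast
qed

definition well_placed :: "tile \<Rightarrow> bool" where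
  "well_placed t \<longleftrightarrow> arm t \<in> lattice_directions \<and> vertices t \<subseteq> quasilattice"

text \<open>
  One edge of the tile fixes everything: its direction puts the arm among the lattice directions,
  and from its end point \<open>P\<close> the remaining vertices are reached by lattice vectors.
\<close>

lemma well_placedI:
  assumes "is_tile t" "closed_segment P Q \<in> edges t" "P \<in> quasilattice"
    and "Q - P = of_real c * u" "c > 0" "u \<in> lattice_directions"
  shows "well_placed t"
proof -
  note e = edge_direction[OF assms(1,2)]
  have D: "arm t \<in> lattice_directions"
    using lattice_direction_parallel[OF assms(6) norm_arm[OF assms(1)] assms(5)] e assms(4) by simp
  note diff = vertex_minus_anchor_in_quasilattice[OF assms(1) D]
  have "v \<in> quasilattice" if "v \<in> vertices t" for v
    using quasilattice_add[OF assms(3) quasilattice_diff[OF diff[OF that] diff[OF e(2)]]] by simp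
  thus ?thesis using D by (auto simp: well_placed_def)
qed

lemma edges_are_segments:
  assumes "e \<in> edges t"
  obtains P Q where "e = closed_segment P Q"
  using assms by (cases t) auto

lemma well_placed_shared_edge:
  assumes "is_tile s" "is_tile t" "well_placed s" "edges s \<inter> edges t \<noteq> {}"
  shows "well_placed t"
proof -
  obtain e where e: "e \<in> edges s" "e \<in> edges t" using assms(4) by blast
  obtain P Q where PQ: "e = closed_segment P Q" using edges_are_segments[OF e(1)] .
  note s = edge_direction[OF assms(1) e(1)[unfolded PQ]]
  obtain c k where c: "c > 0" "Q - P = of_real c * (zeta ^ k * arm s)"
    using s(1) by (auto simp: positive_multiple_of_zeta_pow_def)
  have "zeta ^ k * arm s \<in> lattice_directions"
    using assms(3) zeta_pow_lattice_direction by (simp add: well_placed_def)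
  moreover have "P \<in> quasilattice" using assms(3) s(2) by (auto simp: well_placed_def)
  ultimately show ?thesis using well_placedI[OF assms(2) e(2)[unfolded PQ] _ c(2,1)] by blast
qed


section \<open>Chains of tiles sharing edges\<close>

lemma golden_ge_1: "golden \<ge> 1"
proof -
  have "sqrt 5 \<ge> (1 :: real)" by simp
  thus ?thesis by (simp add: golden_def)
qed

lemma vertices_subset_cball_anchor:
  assumes "is_tile t"
  shows "vertices t \<subseteq> cball (anchor t) 1"
proof -
  have "golden * cmod (zeta\<^sup>2 - zeta + 1) = 1"
    using arg_cong[OF golden_zeta_poly, of cmod] golden_pos by (simp add: norm_mult norm_zeta)
  hence "cmod (zeta\<^sup>2 - zeta + 1) = 1 / golden" using golden_pos by (simp add: field_simps)
  hence q: "cmod (zeta\<^sup>2 - zeta + 1) \<le> 1" using golden_ge_1 by simp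
  show ?thesis
    using assms
  proof (cases rule: tile_cases)
    case (kite a b)
    have "{0, b, zeta * b, zeta\<^sup>2 * b} \<subseteq> cball 0 1"
      using kite(1) by (simp add: norm_mult norm_power norm_zeta)
    thus ?thesis using kite(2,4) by (simp add: dist_norm)
  next
    case (dart a b)
    have "{0, b, (zeta\<^sup>2 - zeta + 1) * b, zeta\<^sup>2 * b} \<subseteq> cball 0 1"
      using dart(1) q by (simp add: norm_mult norm_power norm_zeta)
    thus ?thesis using dart(2,4) by (simp add: dist_norm)
  qed
qed

lemma region_subset_cball_anchor:
  assumes "is_tile t"
  shows "region t \<subseteq> cball (anchor t) 1"
proof -
  have "convex hull X \<subseteq> cball (anchor t) 1" if "X \<subseteq> vertices t" for X
    using that vertices_subset_cball_anchor[OF assms] by (intro hull_minimal) auto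
  thus ?thesis by (cases t) simp_all
qed

lemma closed_region: "closed (region t)"
  by (cases t) (auto intro!: closed_Un compact_imp_closed finite_imp_compact_convex_hull)

text \<open>
  The triangle spanned by the anchor, the end of the arm and the point at distance \<open>1 / golden\<close> on
  the axis of symmetry lies in kites and darts alike, so it provides a disc whose radius and
  relative position are the same for all tiles.
\<close>

lemma ball_subset_region:
  obtains r p where "r > 0" "\<And>t. is_tile t \<Longrightarrow> ball (anchor t + arm t * p) r \<subseteq> region t"
proof -
  define q where "q = zeta\<^sup>2 - zeta + 1"
  have gq: "of_real golden * q = zeta" using golden_zeta_poly by (simp add: q_def)
  have q_not_real: "q \<notin> \<real>"
  proof
    assume "q \<in> \<real>"
    hence "Im (of_real golden * q) = 0" by (auto elim!: Reals_cases)
    hence "sin (pi / 5) = 0" by (simp add: gq zeta_def)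
    moreover have "sin (pi / 5) > 0" by (rule sin_gt_zero) auto
    ultimately show False by simp
  qed
  hence "\<not> collinear {0, 1, q}" by (simp add: collinear_iff_Reals)
  hence "interior (convex hull {0, 1, q}) \<noteq> {}"
    by (simp add: interior_convex_hull_eq_empty collinear_3_eq_affine_dependent)
  then obtain p r where r: "r > 0" "ball p r \<subseteq> convex hull {0, 1, q}"
    by (meson all_not_in_conv mem_interior)
  have "ball (anchor t + arm t * p) r \<subseteq> region t" if t: "is_tile t" for t
  proof
    fix x assume x: "x \<in> ball (anchor t + arm t * p) r"
    define a b where "a = anchor t" and "b = arm t"
    have nb: "cmod b = 1" using norm_arm[OF t] by (simp add: b_def)
    hence b0: "b \<noteq> 0" by auto
    define y where "y = (x - a) / b"
    have xy: "x = a + b * y" using b0 by (simp add: y_def)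
    have "dist (a + b * p) (a + b * y) = dist p y"
      by (simp add: dist_norm norm_mult nb flip: right_diff_distrib)
    hence "y \<in> convex hull {0, 1, q}" using x r(2) by (auto simp: xy a_def b_def)
    hence "x \<in> (+) a ` ((*) b ` (convex hull {0, 1, q}))" by (auto simp: xy)
    moreover have "(+) a ` ((*) b ` (convex hull {0, 1, q})) = convex hull {a, a + b, a + b * q}"
    proof -
      have "linear ((*) b)" by (intro bounded_linear.linear bounded_linear_mult_right)
      hence "(*) b ` (convex hull {0, 1, q}) = convex hull {0, b, b * q}"
        by (simp add: convex_hull_linear_image)
      thus ?thesis by (simp flip: convex_hull_translation)
    qed
    ultimately have x_in: "x \<in> convex hull {a, a + b, a + b * q}" by simp
    show "x \<in> region t"
      using t
    proof (cases rule: tile_cases)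
      case (kite a' b')
      hence ab: "a' = a" "b' = b" by (simp_all add: a_def b_def)
      define K where "K = convex hull {a, a + b, a + zeta * b, a + zeta\<^sup>2 * b}"
      have K: "{a, a + b, a + zeta * b} \<subseteq> K" unfolding K_def
        using hull_subset[of "{a, a + b, a + zeta * b, a + zeta\<^sup>2 * b}" convex] by blast
      have "1 / golden \<le> 1" "0 \<le> 1 / golden" using golden_ge_1 by simp_all
      moreover have "b * q = (1 / golden) *\<^sub>R (zeta * b)"
        using golden_pos by (simp add: gq[symmetric] scaleR_conv_of_real)
      hence "a + b * q = (1 - 1 / golden) *\<^sub>R a + (1 / golden) *\<^sub>R (a + zeta * b)"
        by (simp add: algebra_simps)
      ultimately have "a + b * q \<in> closed_segment a (a + zeta * b)"
        by (auto simp: closed_segment_def)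
      moreover have "closed_segment a (a + zeta * b) \<subseteq> K"
        using K by (intro closed_segment_subset) (auto simp: K_def)
      ultimately have "a + b * q \<in> K" by blast
      hence "convex hull {a, a + b, a + b * q} \<subseteq> K"
        using K by (intro hull_minimal) (auto simp: K_def)
      thus ?thesis using x_in kite(4) by (auto simp: K_def ab)
    next
      case (dart a' b')
      hence ab: "a' = a" "b' = b" by (simp_all add: a_def b_def)
      show ?thesis using x_in unfolding dart(4) ab by (simp add: q_def mult.commute)
    qed
  qed
  thus ?thesis using that r(1) by blast
qed

text \<open>
  Every tile contains a disc of the same radius in its interior, and these interiors are disjoint,
  so the centres of the discs keep a fixed distance from each other; those belonging to tiles
  near a given point also form a bounded set, which is therefore finite.
\<close>

lemma tiling_locally_finite:
  assumes "tiling T"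
  shows "finite {t \<in> T. region t \<inter> cball x \<rho> \<noteq> {}}" (is "finite ?N")
proof -
  obtain r p where r: "r > 0" and "\<And>t. is_tile t \<Longrightarrow> ball (anchor t + arm t * p) r \<subseteq> region t"
    by (rule ball_subset_region) blast
  define m where "m = (\<lambda>t. anchor t + arm t * p)"
  have m: "ball (m t) r \<subseteq> interior (region t)" if "t \<in> T" for t
    using that assms \<open>\<And>t. is_tile t \<Longrightarrow> ball (anchor t + arm t * p) r \<subseteq> region t\<close>
    by (intro interior_maximal) (auto simp: tiling_def m_def)
  have sep: "s = t" if "s \<in> T" "t \<in> T" "dist (m s) (m t) < r" for s t
  proof (rule ccontr)
    assume "s \<noteq> t"
    hence "interior (region s) \<inter> interior (region t) = {}"
      using assms that by (auto simp: tiling_def)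
    moreover have "m t \<in> interior (region s)" "m t \<in> interior (region t)"
      using m[OF that(1)] m[OF that(2)] that(3) r by auto
    ultimately show False by blast
  qed
  have "dist x (m t) \<le> \<rho> + 1 + (1 + cmod p)" if N: "t \<in> ?N" for t
  proof -
    have t: "is_tile t" using N assms by (auto simp: tiling_def)
    obtain y where "y \<in> region t" "dist x y \<le> \<rho>" using N by auto
    moreover from this have "dist (anchor t) y \<le> 1" using region_subset_cball_anchor[OF t] by auto
    moreover have "dist (anchor t) (m t) = cmod p"
      using norm_arm[OF t] by (simp add: m_def dist_norm norm_mult)
    moreover have "dist x (m t) \<le> dist x y + dist y (anchor t) + dist (anchor t) (m t)"
      using dist_triangle[of x "m t" y] dist_triangle[of y "m t" "anchor t"] by linarith
    ultimately show ?thesis by (simp add: dist_commute)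
  qed
  hence "bounded (m ` ?N)" unfolding bounded_def by blast
  moreover have "uniform_discrete (m ` ?N)"
    unfolding uniform_discrete_def using r sep by blast
  ultimately have "finite (m ` ?N)" using uniform_discrete_finite_iff by blast
  moreover have "inj_on m ?N" using sep r by (auto intro!: inj_onI)
  ultimately show ?thesis by (rule finite_imageD)
qed

lemma closed_Union_regions:
  assumes "tiling T" "S \<subseteq> T"
  shows "closed (\<Union>(region ` S))"
proof -
  have "locally_finite_in euclidean (region ` S)"
    unfolding locally_finite_in_def
  proof (intro conjI ballI)
    fix x :: complex
    have "{U \<in> region ` S. U \<inter> ball x 1 \<noteq> {}} \<subseteq> region ` {t \<in> T. region t \<inter> cball x 1 \<noteq> {}}"
    proof
      fix U assume "U \<in> {U \<in> region ` S. U \<inter> ball x 1 \<noteq> {}}"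
      then obtain t where "t \<in> T" "U = region t" "region t \<inter> ball x 1 \<noteq> {}"
        using assms(2) by auto
      moreover have "ball x 1 \<subseteq> cball x 1" by (rule ball_subset_cball)
      ultimately show "U \<in> region ` {t \<in> T. region t \<inter> cball x 1 \<noteq> {}}" by blast
    qed
    hence "finite {U \<in> region ` S. U \<inter> ball x 1 \<noteq> {}}"
      using tiling_locally_finite[OF assms(1)] by (meson finite_imageI finite_subset)
    thus "\<exists>V. openin euclidean V \<and> x \<in> V \<and> finite {U \<in> region ` S. U \<inter> V \<noteq> {}}"
      by (intro exI[of _ "ball x 1"]) simp
  qed simp
  hence "closedin euclidean (\<Union>(region ` S))"
    by (intro closedin_locally_finite_Union) (auto simp: closed_region)
  thus ?thesis by simp
qed

lemma uncountable_region:
  assumes "is_tile t"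
  shows "uncountable (region t)"
proof -
  obtain r p where "r > 0" "\<And>t. is_tile t \<Longrightarrow> ball (anchor t + arm t * p) r \<subseteq> region t"
    by (rule ball_subset_region) blast
  thus ?thesis using assms uncountable_ball countable_subset by blast
qed

lemma tiling_countable:
  assumes "tiling T"
  shows "countable T"
proof -
  have "T \<subseteq> (\<Union>n. {t \<in> T. region t \<inter> cball 0 (real n) \<noteq> {}})"
  proof
    fix t assume t: "t \<in> T"
    hence "uncountable (region t)" using assms by (simp add: tiling_def uncountable_region)
    hence "region t \<noteq> {}" by auto
    then obtain x where x: "x \<in> region t" by blast
    obtain n :: nat where "cmod x \<le> real n" using real_arch_simple by blast
    hence "x \<in> region t \<inter> cball 0 (real n)" using x by simp
    thus "t \<in> (\<Union>n. {t \<in> T. region t \<inter> cball 0 (real n) \<noteq> {}})" using t by blast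
  qed
  moreover have "countable (\<Union>n. {t \<in> T. region t \<inter> cball 0 (real n) \<noteq> {}})"
    by (intro countable_UN[OF countableI_type] countable_finite tiling_locally_finite[OF assms])
  ultimately show ?thesis by (rule countable_subset)
qed

lemma countable_vertices: "countable (vertices t)"
  by (cases t) auto

text \<open>
  The tiles with property \<open>P\<close> and those without it would share no edge. So the two closed sets that
  they cover could meet only in vertices, and would disconnect the complement of the countable
  set of all vertices.
\<close>

theorem tiling_edge_induct:
  assumes "tiling T" "edge_to_edge T" "t0 \<in> T" "P t0" "t \<in> T"
    and step: "\<And>s t. s \<in> T \<Longrightarrow> t \<in> T \<Longrightarrow> P s \<Longrightarrow> edges s \<inter> edges t \<noteq> {} \<Longrightarrow> P t"
  shows "P t"
proof (rule ccontr)
  assume nP: "\<not> P t"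
  define good bad where "good = \<Union>(region ` {t \<in> T. P t})" and "bad = \<Union>(region ` {t \<in> T. \<not> P t})"
  define V where "V = \<Union>(vertices ` T)"
  have "countable V"
    unfolding V_def using tiling_countable[OF assms(1)] countable_vertices by (intro countable_UN)
  hence "connected (- V)"
    by (intro path_connected_imp_connected path_connected_complement_countable) auto
  moreover have "good \<inter> bad \<inter> - V = {}"
  proof -
    have "x \<in> V" if s: "s \<in> T" "P s" "x \<in> region s" and t: "t \<in> T" "\<not> P t" "x \<in> region t" for x s t
    proof -
      have "s \<noteq> t" using s t by auto
      hence "region s \<inter> region t = (vertices s \<inter> vertices t) \<union> \<Union>(edges s \<inter> edges t)"
        using assms(2) s t unfolding edge_to_edge_def by blast
      moreover have "edges s \<inter> edges t = {}" using step[OF s(1) t(1) s(2)] t(2) by blast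
      ultimately have "x \<in> vertices s" using s(3) t(3) by auto
      thus ?thesis using s(1) by (auto simp: V_def)
    qed
    thus ?thesis by (auto simp: good_def bad_def)
  qed
  moreover have "- V \<subseteq> good \<union> bad"
  proof -
    have "good \<union> bad = \<Union>(region ` T)" by (auto simp: good_def bad_def)
    thus ?thesis using assms(1) by (simp add: tiling_def)
  qed
  moreover have "closed good" "closed bad"
    unfolding good_def bad_def using closed_Union_regions[OF assms(1)] by auto
  ultimately have "good \<inter> - V = {} \<or> bad \<inter> - V = {}"
    by (rule connected_closedD)
  hence "region t0 \<subseteq> V \<or> region t \<subseteq> V"
    using assms(3,4,5) nP by (auto simp: good_def bad_def)
  moreover have "\<not> region s \<subseteq> V" if "s \<in> T" for s
    using uncountable_region[of s] that assms(1) countable_subset[OF _ \<open>countable V\<close>]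
    by (auto simp: tiling_def)
  ultimately show False using assms(3,5) by blast
qed


section \<open>Position of the tiles of a normalized tiling\<close>

lemma normalized_all_well_placed:
  assumes "tiling T" "edge_to_edge T" "normalized_coordinates T" "t \<in> T"
  shows "well_placed t"
proof -
  have tile: "is_tile s" if "s \<in> T" for s using that assms(1) by (auto simp: tiling_def)
  obtain t0 P c where t0: "t0 \<in> T" "closed_segment 0 P \<in> edges t0" "c > 0" "P = c *\<^sub>R Ystar 0"
    using assms(3) by (auto simp: normalized_coordinates_def)
  have "Ystar 0 \<in> lattice_directions"
    unfolding Ystar_eq_zeta lattice_directions_def by blast
  hence "well_placed t0"
    using t0 quasilattice_zero
    by (intro well_placedI[OF tile[OF t0(1)] t0(2), of c "Ystar 0"]) (auto simp: scaleR_conv_of_real)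
  thus ?thesis
    using tiling_edge_induct[of T t0 well_placed t] assms t0(1) tile well_placed_shared_edge by blast
qed

lemma well_placed_kite:
  assumes "is_tile (Kite E B A G)" "well_placed (Kite E B A G)"
  shows "\<exists>k\<le>4. \<exists>v. Kite E B A G = translate v (Delta_plus k) \<or>
                   Kite E B A G = translate v (Delta_minus k)"
proof -
  have AE: "A - E = zeta * (B - E)" "G - E = zeta\<^sup>2 * (B - E)" "dist E B = 1"
    using assms(1) is_tile_Kite_iff[of E B A G] by (simp_all add: zeta_def del: is_tile.simps)
  hence "is_tile (Kite 0 (B - E) (A - E) (G - E))"
    unfolding is_tile_Kite_iff by (simp add: zeta_def dist_norm norm_minus_commute)
  moreover have "A - E \<in> lattice_directions"
    using assms(2) zeta_pow_lattice_direction[of "B - E" 1] AE(1) by (simp add: well_placed_def)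
  then obtain k where k: "k \<le> 4" "A - E = Ystar k \<or> A - E = - Ystar k"
    by (rule lattice_direction_cases)
  ultimately have "Kite 0 (B - E) (A - E) (G - E) = Delta_plus k \<or>
      Kite 0 (B - E) (A - E) (G - E) = Delta_minus k"
    using Delta_plus_unique Delta_minus_unique by blast
  moreover have "Kite E B A G = translate E (Kite 0 (B - E) (A - E) (G - E))" by simp
  ultimately show ?thesis using k(1) by metis
qed

theorem proposition2p2:
  fixes T :: "tile set"
  assumes "kite_dart_tiling T"
    and "normalized_coordinates T"
  shows "(\<forall>E B A G. Kite E B A G \<in> T \<longrightarrow>
            (\<exists>k\<le>4. \<exists>v. Kite E B A G = translate v (Delta_plus k) \<or>
                        Kite E B A G = translate v (Delta_minus k)))
         \<and> (\<forall>t\<in>T. vertices t \<subseteq> quasilattice)"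
proof -
  have T: "tiling T" "edge_to_edge T" using assms(1) by (auto simp: kite_dart_tiling_def)
  have tile: "is_tile t" if "t \<in> T" for t using that T(1) by (auto simp: tiling_def)
  have placed: "well_placed t" if "t \<in> T" for t
    using normalized_all_well_placed[OF T assms(2) that] .
  show ?thesis
    using well_placed_kite tile placed well_placed_def by blast
qed

end
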